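(* If $G$ is an isolate-free graph, then $\Gamma_t(G) \le \gamma_t^{\mathrm{i}}(G)$.
   Context: All graphs are finite and simple. A graph is isolate-free if it has no vertex of degree $0$. A vertex $u$ totally dominates a vertex $v$ in $G$ if $u$ is adjacent to $v$. A total dominating set (TD-set) of $G$ is a set $S \subseteq V(G)$ such that every vertex of $G$ has a neighbor in $S$. The upper total domination number $\Gamma_t(G)$ is the maximum cardinality of a minimal (with respect to inclusion) TD-set of $G$. The indicated total domination game is played on an isolate-free graph $G$ by two players, Dominator and Staller. In each of his moves, Dominator indicates a vertex $v$ of $G$ that has not been totally dominated by the vertices selected so far, and Staller responds by selecting any vertex from the open neighborhood $N_G(v)$ and adding it to a set $D$ (initially empty) that is being built. The game ends when every vertex of $G$ is totally dominated, that is, when $D$ is a TD-set of $G$. Dominator aims to minimize $|D|$ and Staller aims to maximize $|D|$. The size of the final set $D$ when both play optimally is the indicated total domination number $\gamma_t^{\mathrm{i}}(G)$. *)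

theory Defs
  imports "Graph_Theory.Digraph"
begin

text \<open>
  A finite simple graph is modelled by the AFP locale \<^locale>\<open>graph\<close> (a finite symmetric digraph
  without loops or parallel arcs). An edge between u and v is a pair of opposite arcs, so the degree
  of a vertex is its out-degree, and \<open>u \<rightarrow>\<^bsub>G\<^esub> v\<close>, which the library reads
  ``u dominates v'', is adjacency.
\<close>

locale isolate_free_graph = graph +
  assumes no_isolated: "v \<in> verts G \<Longrightarrow> out_degree G v \<noteq> 0"

definition open_neighborhood :: "('a, 'b) pre_digraph \<Rightarrow> 'a \<Rightarrow> 'a set" where
  "open_neighborhood G v = {u \<in> verts G. u \<rightarrow>\<^bsub>G\<^esub> v}"

definition total_dominating_set :: "('a, 'b) pre_digraph \<Rightarrow> 'a set \<Rightarrow> bool" where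
  "total_dominating_set G S \<longleftrightarrow>
     S \<subseteq> verts G \<and> (\<forall>v \<in> verts G. \<exists>u \<in> S. u \<rightarrow>\<^bsub>G\<^esub> v)"

definition minimal_total_dominating_set :: "('a, 'b) pre_digraph \<Rightarrow> 'a set \<Rightarrow> bool" where
  "minimal_total_dominating_set G S \<longleftrightarrow>
     total_dominating_set G S \<and> (\<forall>T. T \<subset> S \<longrightarrow> \<not> total_dominating_set G T)"

definition upper_total_domination_number :: "('a, 'b) pre_digraph \<Rightarrow> nat" where
  "upper_total_domination_number G = Max {card S | S. minimal_total_dominating_set G S}"

definition not_totally_dominated :: "('a, 'b) pre_digraph \<Rightarrow> 'a set \<Rightarrow> 'a set" where
  "not_totally_dominated G D = {v \<in> verts G. \<not> (\<exists>u \<in> D. u \<rightarrow>\<^bsub>G\<^esub> v)}"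

text \<open>
  The minimax value of the indicated total domination game from the position in which the set
  selected so far is D and Dominator is to move: he indicates v, Staller answers with a neighbor u
  of v, and the payoff is the size of the final set.
\<close>

context graph
begin

function indicated_game_value :: "'a set \<Rightarrow> nat" where
  "indicated_game_value D =
     (if not_totally_dominated G D = {} then card D
      else (MIN v \<in> not_totally_dominated G D.
              MAX u \<in> open_neighborhood G v. indicated_game_value (insert u D)))"
  by auto
termination
proof (relation "measure (\<lambda>D. card (verts G - D))")
  fix D v u
  assume "v \<in> not_totally_dominated G D" and "u \<in> open_neighborhood G v"
  then have "verts G - insert u D \<subset> verts G - D"
    by (auto simp: not_totally_dominated_def open_neighborhood_def)
  then show "(insert u D, D) \<in> measure (\<lambda>D. card (verts G - D))"
    by (simp add: psubset_card_mono)
qed simp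

declare indicated_game_value.simps [simp del]

end

text \<open>The locale supplies the finiteness that makes the recursion terminate.\<close>

definition indicated_total_domination_number :: "('a, 'b) pre_digraph \<Rightarrow> nat" where
  "indicated_total_domination_number G = graph.indicated_game_value G {}"

text \<open>
  In an isolate-free graph every minimum and maximum taken above ranges over a finite nonempty set.
\<close>

context isolate_free_graph
begin

lemma finite_not_totally_dominated: "finite (not_totally_dominated G D)"
  by (simp add: not_totally_dominated_def)

lemma finite_open_neighborhood: "finite (open_neighborhood G v)"
  by (simp add: open_neighborhood_def)

lemma open_neighborhood_nonempty:
  assumes "v \<in> verts G"
  shows "open_neighborhood G v \<noteq> {}"
proof -
  have "out_arcs G v \<noteq> {}"
    using no_isolated [OF assms] by (auto simp: out_degree_def)
  then obtain u where "v \<rightarrow>\<^bsub>G\<^esub> u"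
    by (auto simp: out_arcs_def arcs_ends_conv)
  then have "u \<rightarrow>\<^bsub>G\<^esub> v"
    using sym_arcs by (rule arcs_ends_symmetric [rotated])
  then show ?thesis
    using adj_in_verts by (auto simp: open_neighborhood_def)
qed

lemma finite_minimal_total_dominating_sets: "finite {S. minimal_total_dominating_set G S}"
  by (rule finite_subset [of _ "Pow (verts G)"])
     (auto simp: minimal_total_dominating_set_def total_dominating_set_def)

lemma minimal_total_dominating_set_exists: "\<exists>S. minimal_total_dominating_set G S"
proof -
  have "total_dominating_set G (verts G)"
    using open_neighborhood_nonempty
    by (auto simp: total_dominating_set_def open_neighborhood_def)
  moreover have "finite {S. total_dominating_set G S}"
    by (rule finite_subset [of _ "Pow (verts G)"]) (auto simp: total_dominating_set_def)
  ultimately obtain S where "total_dominating_set G S"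
      and "\<forall>T \<in> {S. total_dominating_set G S}. T \<subseteq> S \<longrightarrow> S = T"
    using finite_has_minimal [of "{S. total_dominating_set G S}"] by auto
  then show ?thesis
    unfolding minimal_total_dominating_set_def by blast
qed

end

end

theory Submission
  imports Defs
begin

text \<open>
  Staller has a simple strategy that secures the size of any chosen minimal total dominating set S:
  whenever Dominator indicates a vertex, answer with one of its neighbors in S. Such a neighbor
  exists because S is totally dominating. The selected vertices then always form a subset of S, and
  when the game ends they form a total dominating set, so by minimality they are all of S. Taking S
  of size \<^term>\<open>upper_total_domination_number G\<close> gives the inequality.
\<close>

context isolate_free_graph
begin

text \<open>
  The positions reachable under Staller's strategy are the subsets of S. The induction follows the
  game tree from such a position: the final position can only be S itself, and before that each
  indicated vertex has an answer that keeps the position inside S.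
\<close>

lemma card_le_indicated_game_value:
  assumes "minimal_total_dominating_set G S" and "D \<subseteq> S"
  shows "card S \<le> indicated_game_value D"
  using assms(2)
proof (induction D rule: indicated_game_value.induct)
  case (1 D)
  from assms(1) have S: "total_dominating_set G S"
    by (simp add: minimal_total_dominating_set_def)
  show ?case
  proof (cases "not_totally_dominated G D = {}")
    case True
    with S \<open>D \<subseteq> S\<close> have "total_dominating_set G D"
      by (auto simp: total_dominating_set_def not_totally_dominated_def)
    with assms(1) \<open>D \<subseteq> S\<close> have "D = S"
      by (auto simp: minimal_total_dominating_set_def)
    with True show ?thesis
      by (simp add: indicated_game_value.simps)
  next
    case False
    have "card S \<le> (MAX u \<in> open_neighborhood G v. indicated_game_value (insert u D))"
      if v: "v \<in> not_totally_dominated G D" for v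
    proof -
      from v S obtain u where "u \<in> S" and u: "u \<in> open_neighborhood G v"
        by (force simp: total_dominating_set_def not_totally_dominated_def open_neighborhood_def)
      with 1 False v have "card S \<le> indicated_game_value (insert u D)"
        by simp
      also from u have "\<dots> \<le> (MAX u \<in> open_neighborhood G v. indicated_game_value (insert u D))"
        by (simp add: finite_open_neighborhood)
      finally show ?thesis .
    qed
    with False show ?thesis
      by (subst indicated_game_value.simps) (simp add: finite_not_totally_dominated)
  qed
qed

end

theorem proposition1:
  fixes G :: "('a, 'b) pre_digraph"
  assumes "isolate_free_graph G"
  shows "upper_total_domination_number G \<le> indicated_total_domination_number G"
proof -
  interpret isolate_free_graph G
    by (fact assms)
  have "finite {card S | S. minimal_total_dominating_set G S}"
    using finite_minimal_total_dominating_sets by simp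
  moreover have "{card S | S. minimal_total_dominating_set G S} \<noteq> {}"
    using minimal_total_dominating_set_exists by simp
  ultimately show ?thesis
    unfolding upper_total_domination_number_def indicated_total_domination_number_def
    by (auto simp: card_le_indicated_game_value)
qed

end
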